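(* Let $c>0$ and let $\mathcal{F}_c:\mathbb{R}\to[-c,c]$ be defined by $\mathcal{F}_c(z)=-c$ if $z<-c$, $\mathcal{F}_c(z)=z$ if $-c\le z\le c$, and $\mathcal{F}_c(z)=c$ if $z>c$. Let $G=(V,E)$ be a complete signed graph on $V=\{1,\dots,n\}$ that is structurally balanced with respect to a partition $V=V_1\cup V_2$. Let $\alpha\in(0,1/2)$ and $\beta>0$, and define $\theta:E\to\mathbb{R}$ by $\theta(\{i,j\})=\alpha$ if $\{i,j\}\in E^+$ and $\theta(\{i,j\})=-\beta$ if $\{i,j\}\in E^-$. Consider the random dynamics on $x(t)\in[-c,c]^n$ in which at each time $t$ an edge $\{i,j\}\in E$ is selected by the random pair selection process and $$x_s(t+1)=\mathcal{F}_c\big((1-\theta(\{i,j\}))x_s(t)+\theta(\{i,j\})x_{-s}(t)\big),\quad s\in\{i,j\},\ \{-s\}=\{i,j\}\setminus\{s\},$$ while $x_k(t+1)=x_k(t)$ for all $k\notin\{i,j\}$. Then there exists $\beta_0>0$ such that for every $\beta>\beta_0$ and for Lebesgue-almost every initial value $x(0)$, there is a random variable $l(x(0))$ taking values in $\{-c,c\}$ such that $$\mathbb{P}\Big(\lim_{t\to\infty}x_i(t)=l(x(0))\ \forall i\in V_1;\ \lim_{t\to\infty}x_i(t)=-l(x(0))\ \forall i\in V_2\Big)=1.$$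
   Context: A signed graph is an undirected simple graph whose edge set $E$ is partitioned into positive edges $E^+$ and negative edges $E^-$; it is complete if every pair of distinct nodes is joined by an edge (positive or negative). A signed graph is structurally balanced if there is a partition $V=V_1\cup V_2$ into two nonempty disjoint sets such that every edge between $V_1$ and $V_2$ is negative and every edge within $V_1$ or within $V_2$ is positive. Random pair selection process: the edges selected at times $t=0,1,2,\dots$ are independent, each drawn uniformly at random from $E$. *)

theory Defs
  imports "HOL-Probability.Probability"
begin

definition sat :: "real \<Rightarrow> real \<Rightarrow> real" where
  "sat c z = (if z < -c then -c else if z \<le> c then z else c)"

definition complete_signed_graph :: "'a set \<Rightarrow> 'a set set \<Rightarrow> 'a set set \<Rightarrow> bool" where
  "complete_signed_graph V Ep En \<longleftrightarrow>
     Ep \<inter> En = {} \<and> Ep \<union> En = {{i, j} | i j. i \<in> V \<and> j \<in> V \<and> i \<noteq> j}"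

definition structurally_balanced ::
  "'a set \<Rightarrow> 'a set set \<Rightarrow> 'a set set \<Rightarrow> 'a set \<Rightarrow> 'a set \<Rightarrow> bool" where
  "structurally_balanced V Ep En V1 V2 \<longleftrightarrow>
     V1 \<union> V2 = V \<and> V1 \<inter> V2 = {} \<and> V1 \<noteq> {} \<and> V2 \<noteq> {} \<and>
     (\<forall>e \<in> Ep \<union> En. \<forall>i j. e = {i, j} \<and> i \<in> V1 \<and> j \<in> V2 \<longrightarrow> e \<in> En) \<and>
     (\<forall>e \<in> Ep \<union> En. \<forall>i j. e = {i, j} \<and> ((i \<in> V1 \<and> j \<in> V1) \<or> (i \<in> V2 \<and> j \<in> V2))
        \<longrightarrow> e \<in> Ep)"

definition theta :: "'a set set \<Rightarrow> real \<Rightarrow> real \<Rightarrow> 'a set \<Rightarrow> real" where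
  "theta Ep \<alpha> \<beta> e = (if e \<in> Ep then \<alpha> else - \<beta>)"

text \<open>One update step along the selected edge e = {i,j}; for s in e, the other endpoint
  is the unique element of e - {s}.\<close>
definition upd_step ::
  "real \<Rightarrow> ('n set \<Rightarrow> real) \<Rightarrow> 'n set \<Rightarrow> real ^ 'n \<Rightarrow> real ^ 'n" where
  "upd_step c th e x = (\<chi> k. if k \<in> e
       then sat c ((1 - th e) * x $ k + th e * x $ (THE s. s \<in> e - {k}))
       else x $ k)"

primrec traj ::
  "real \<Rightarrow> ('n set \<Rightarrow> real) \<Rightarrow> real ^ 'n \<Rightarrow> (nat \<Rightarrow> 'n set) \<Rightarrow> nat \<Rightarrow> real ^ 'n" where
  "traj c th x0 \<omega> 0 = x0"
| "traj c th x0 \<omega> (Suc t) = upd_step c th (\<omega> t) (traj c th x0 \<omega> t)"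

definition pair_selection :: "'n set set \<Rightarrow> (nat \<Rightarrow> 'n set) measure" where
  "pair_selection E = (\<Pi>\<^sub>M t\<in>(UNIV :: nat set). measure_pmf (pmf_of_set E))"

end

theory Submission
  imports Defs
begin

text \<open>
  Let \<open>D\<close> be the largest distance between the opinions of two nodes on opposite sides. It vanishes
  only on a null set. An edge inside one side, or a cross edge, shrinks \<open>D\<close> at most by a factor
  \<open>\<kappa> = min (1/2) (1 - 2\<alpha>)\<close> independent of \<open>\<beta>\<close>, while the cross edge realising \<open>D\<close>, drawn with
  probability at least \<open>1/|E|\<close>, multiplies \<open>D\<close> by at least \<open>\<beta>\<close> up to saturation at \<open>2c\<close>. Hence for some
  small \<open>s > 0\<close> and all large \<open>\<beta>\<close> the function \<open>D\<^sup>-\<^sup>s\<close> satisfies a geometric drift condition, so that its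
  expectation stays bounded along the process. From any state with \<open>D \<ge> \<delta>\<close> a fixed number of
  suitable edges leads to one of the two absorbing polarized states; since
  \<open>P(D < \<delta>)\<close> is at most \<open>\<delta>\<^sup>s\<close> times a constant uniformly in time, letting \<open>\<delta>\<close> tend to 0 shows that absorption is
  almost sure.
\<close>

section \<open>Iterated uniform choice of a map\<close>

locale finite_choice =
  fixes E :: "'e set" and U :: "'e \<Rightarrow> 's \<Rightarrow> 's"
  assumes fin: "finite E" and nonempty: "E \<noteq> {}"
begin

text \<open>The one-step Markov operator of the chain that applies \<open>U e\<close> for uniform
  \<open>e\<close>; its \<open>t\<close>-th iterate gives expectations after \<open>t\<close>
  steps.\<close>

definition avg :: "('s \<Rightarrow> real) \<Rightarrow> 's \<Rightarrow> real" where
  "avg f x = (\<Sum>e\<in>E. f (U e x)) / card E"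

lemma card_pos: "0 < real (card E)"
  using fin nonempty by (simp add: card_gt_0_iff)

lemma avg_affine: "avg (\<lambda>x. a * f x + b * g x + d) x = a * avg f x + b * avg g x + d"
  using card_pos unfolding avg_def
  by (simp add: sum.distrib sum_distrib_left add_divide_distrib)

text \<open>Trajectories started in an invariant set \<open>X\<close> only evaluate the functions on
  \<open>X\<close>. This matters because the drift bound is available only on such a set.\<close>

lemma funpow_avg_mono:
  assumes inv: "\<And>x e. x \<in> X \<Longrightarrow> e \<in> E \<Longrightarrow> U e x \<in> X"
    and le: "\<And>x. x \<in> X \<Longrightarrow> f x \<le> g x"
  shows "x \<in> X \<Longrightarrow> (avg ^^ t) f x \<le> (avg ^^ t) g x"
proof (induction t arbitrary: x)
  case (Suc t)
  then show ?case
    using card_pos by (auto simp: avg_def intro!: divide_right_mono sum_mono inv)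
qed (use le in auto)

lemma funpow_avg_affine:
  "(avg ^^ t) (\<lambda>x. a * f x + b * g x + d) x = a * (avg ^^ t) f x + b * (avg ^^ t) g x + d"
proof (induction t arbitrary: x)
  case (Suc t)
  have "(avg ^^ t) (\<lambda>x. a * f x + b * g x + d) = (\<lambda>x. a * (avg ^^ t) f x + b * (avg ^^ t) g x + d)"
    using Suc by blast
  then show ?case by (simp add: avg_affine)
qed auto

lemma funpow_avg_const: "(avg ^^ t) (\<lambda>_. d) x = d"
  using funpow_avg_affine[of t 0 "\<lambda>_. 0" 0 "\<lambda>_. 0" d x] by simp

lemma avg_le_one_good:
  assumes "e \<in> E" "f (U e x) \<le> a" "\<And>e'. e' \<in> E \<Longrightarrow> f (U e' x) \<le> b"
  shows "avg f x \<le> (1 / card E) * a + (1 - 1 / card E) * b"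
proof -
  have "(\<Sum>e\<in>E. f (U e x)) = f (U e x) + (\<Sum>e\<in>E - {e}. f (U e x))"
    using assms(1) fin by (simp add: sum.remove)
  also have "\<dots> \<le> a + (\<Sum>e\<in>E - {e}. b)"
    using assms by (intro add_mono sum_mono) auto
  also have "\<dots> = a + (real (card E) - 1) * b"
    using assms(1) fin card_pos by (simp add: card_Diff_singleton of_nat_diff)
  finally show ?thesis
    using card_pos unfolding avg_def by (simp add: field_simps)
qed

text \<open>The exact word \<open>es\<close> is drawn with probability
  \<open>(1 / card E) ^ length es\<close>. The induction peels off its first letter and bounds every
  other branch by 1.\<close>

lemma hitting_prob_lower:
  assumes "set es \<subseteq> E" "fold U es x \<in> A"
  shows "(avg ^^ length es) (indicator (- A)) x \<le> 1 - (1 / card E) ^ length es"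
  using assms
proof (induction es arbitrary: x)
  case (Cons e es)
  let ?f = "(avg ^^ length es) (indicator (- A))"
  have "?f y \<le> 1" for y
    using funpow_avg_mono[of UNIV "indicator (- A)" "\<lambda>_. 1" y "length es"]
    by (simp add: funpow_avg_const indicator_def)
  moreover have "?f (U e x) \<le> 1 - (1 / card E) ^ length es"
    using Cons by simp
  ultimately have "avg ?f x \<le> (1 / card E) * (1 - (1 / card E) ^ length es) + (1 - 1 / card E) * 1"
    using Cons.prems by (intro avg_le_one_good[of e]) auto
  then show ?case by (simp add: algebra_simps)
qed auto

text \<open>For absorbing \<open>A\<close>, one averaging step does not increase the indicator of
  the complement, and the iterates of \<open>avg\<close> are monotone.\<close>

lemma survival_antimono:
  assumes "\<And>x e. x \<in> A \<Longrightarrow> e \<in> E \<Longrightarrow> U e x \<in> A"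
  shows "antimono (\<lambda>t. (avg ^^ t) (indicator (- A)) x)"
proof (rule decseq_SucI)
  fix t
  have "avg (indicator (- A)) y \<le> indicator (- A) y" for y
  proof (cases "y \<in> A")
    case True
    then show ?thesis using assms by (simp add: avg_def)
  next
    case False
    have "avg (indicator (- A)) y \<le> (\<Sum>e\<in>E. 1) / card E"
      unfolding avg_def by (intro divide_right_mono sum_mono) (auto simp: indicator_def)
    then show ?thesis using False card_pos by simp
  qed
  then have "(avg ^^ t) (avg (indicator (- A))) x \<le> (avg ^^ t) (indicator (- A)) x"
    using funpow_avg_mono[of UNIV] by simp
  then show "(avg ^^ Suc t) (indicator (- A)) x \<le> (avg ^^ t) (indicator (- A)) x"
    by (simp add: funpow_swap1)
qed

text \<open>Foster-Lyapunov bound: \<open>K / (1 - \<rho>)\<close> solves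
  \<open>r = \<rho> * r + K\<close>, so the claimed bound reproduces itself under induction.\<close>

lemma funpow_avg_drift:
  assumes inv: "\<And>x e. x \<in> X \<Longrightarrow> e \<in> E \<Longrightarrow> U e x \<in> X"
    and nonneg: "\<And>x. x \<in> X \<Longrightarrow> 0 \<le> g x"
    and drift: "\<And>x. x \<in> X \<Longrightarrow> avg g x \<le> \<rho> * g x + K"
    and \<rho>: "0 \<le> \<rho>" "\<rho> < 1" and "0 \<le> K" and x: "x \<in> X"
  shows "(avg ^^ t) g x \<le> g x + K / (1 - \<rho>)"
proof (induction t)
  case 0
  then show ?case using \<rho> \<open>0 \<le> K\<close> by simp
next
  case (Suc t)
  have "(avg ^^ Suc t) g x = (avg ^^ t) (avg g) x"
    by (simp add: funpow_swap1)
  also have "\<dots> \<le> (avg ^^ t) (\<lambda>y. \<rho> * g y + 0 * g y + K) x"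
    using drift by (intro funpow_avg_mono[of X] inv x) auto
  also have "\<dots> = \<rho> * (avg ^^ t) g x + K"
    by (subst funpow_avg_affine) simp
  also have "\<dots> \<le> \<rho> * (g x + K / (1 - \<rho>)) + K"
    using Suc \<rho> by (simp add: mult_left_mono)
  also have "\<dots> = \<rho> * g x + K / (1 - \<rho>)"
    using \<rho> by (simp add: field_simps)
  also have "\<dots> \<le> g x + K / (1 - \<rho>)"
    using nonneg[OF x] \<rho> by (simp add: mult_left_le_one_le)
  finally show ?case .
qed

text \<open>States with \<open>g \<le> R\<close> enter \<open>A\<close> within a fixed time with
  probability bounded below; states with \<open>g > R\<close> are rare uniformly in time by the
  drift bound. Passing to the limit in time and then letting \<open>R\<close> grow forces the limit
  to 0.\<close>

lemma survival_tendsto_0: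
  assumes inv: "\<And>x e. x \<in> X \<Longrightarrow> e \<in> E \<Longrightarrow> U e x \<in> X"
    and absorbing: "\<And>x e. x \<in> A \<Longrightarrow> e \<in> E \<Longrightarrow> U e x \<in> A"
    and nonneg: "\<And>x. x \<in> X \<Longrightarrow> 0 \<le> g x"
    and drift: "\<And>x. x \<in> X \<Longrightarrow> avg g x \<le> \<rho> * g x + K"
    and \<rho>: "0 \<le> \<rho>" "\<rho> < 1" and K: "0 \<le> K"
    and reach: "\<And>R. \<exists>T. \<forall>x\<in>X. g x \<le> R \<longrightarrow>
      (\<exists>es. length es = T \<and> set es \<subseteq> E \<and> fold U es x \<in> A)"
    and x: "x \<in> X"
  shows "(\<lambda>t. (avg ^^ t) (indicator (- A)) x) \<longlonglongrightarrow> 0"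
proof -
  define Q where "Q t = (avg ^^ t) (indicator (- A)) x" for t
  define B where "B = g x + K / (1 - \<rho>)"
  have Q0: "0 \<le> Q t" for t
    using funpow_avg_mono[of UNIV "\<lambda>_. 0" "indicator (- A)" x t]
    by (simp add: Q_def funpow_avg_const)
  have Qdec: "decseq Q"
    unfolding Q_def using survival_antimono[OF absorbing] .
  then obtain L where L: "Q \<longlonglongrightarrow> L" "0 \<le> L"
    using Q0 by (metis decseq_convergent LIMSEQ_le_const)
  have "L \<le> B / R" if "R > 0" for R
  proof -
    obtain T where T: "\<And>y. y \<in> X \<Longrightarrow> g y \<le> R \<Longrightarrow>
      (\<exists>es. length es = T \<and> set es \<subseteq> E \<and> fold U es y \<in> A)"
      using reach[of R] by blast
    define q where "q = (1 / real (card E)) ^ T"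
    have q: "0 < q" using card_pos by (simp add: q_def)
    \<comment> \<open>The coefficient of \<open>g\<close> carries the factor \<open>q\<close>, which
      depends on \<open>R\<close> through \<open>T\<close>; it cancels later and leaves
      \<open>L \<le> B / R\<close>. Outside \<open>A\<close>, the right side is at least 1 as soon
      as \<open>g y > R\<close>.\<close>
    have step: "(avg ^^ T) (indicator (- A)) y \<le> (1 - q) * indicator (- A) y + (q / R) * g y + 0"
      if y: "y \<in> X" for y
    proof -
      have le: "(avg ^^ T) (indicator (- A)) y \<le> indicator (- A) y"
        using survival_antimono[OF absorbing, of y, THEN antimonoD, of 0 T] by simp
      have gR: "0 \<le> (q / R) * g y" using nonneg[OF y] q \<open>R > 0\<close> by simp
      show ?thesis
      proof (cases "y \<in> A")
        case True
        then show ?thesis using le gR by simp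
      next
        case False
        show ?thesis
        proof (cases "g y \<le> R")
          case True
          then obtain es where es: "length es = T" "set es \<subseteq> E" "fold U es y \<in> A"
            using T y by blast
          then show ?thesis
            using hitting_prob_lower[OF es(2,3)] gR False by (simp add: q_def)
        next
          case gy: False
          have "q * 1 \<le> q * (g y / R)"
            using gy q \<open>R > 0\<close> by (intro mult_left_mono) (auto simp: field_simps)
          then show ?thesis using False le by simp
        qed
      qed
    qed
    have "Q (t + T) \<le> (1 - q) * Q t + q / R * B" for t
    proof -
      \<comment> \<open>The \<open>t + T\<close> steps are read as \<open>t\<close> steps from
        \<open>x\<close> followed by \<open>T\<close> steps, to which \<open>step\<close>
        applies.\<close>
      have "Q (t + T) \<le> (avg ^^ t) (\<lambda>y. (1 - q) * indicator (- A) y + (q / R) * g y + 0) x"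
        unfolding Q_def funpow_add o_def
        by (rule funpow_avg_mono[of X]) (use inv step x in auto)
      also have "\<dots> = (1 - q) * Q t + (q / R) * (avg ^^ t) g x"
        by (subst funpow_avg_affine) (simp add: Q_def)
      also have "\<dots> \<le> (1 - q) * Q t + (q / R) * B"
        using funpow_avg_drift[OF inv nonneg drift \<rho> K x] q \<open>R > 0\<close>
        by (intro add_left_mono mult_left_mono) (auto simp: B_def)
      finally show ?thesis .
    qed
    moreover have "(\<lambda>t. Q (t + T)) \<longlonglongrightarrow> L"
      using L(1) by (rule LIMSEQ_ignore_initial_segment)
    moreover have "(\<lambda>t. (1 - q) * Q t + q / R * B) \<longlonglongrightarrow> (1 - q) * L + q / R * B"
      by (intro tendsto_intros L(1))
    ultimately have "L \<le> (1 - q) * L + q / R * B"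
      by (intro LIMSEQ_le) auto
    then have "q * L \<le> q * (B / R)" by (simp add: algebra_simps)
    then show ?thesis by (rule mult_left_le_imp_le[OF _ q])
  qed
  then have "eventually (\<lambda>R. L \<le> B / R) at_top"
    using eventually_gt_at_top[of "0::real"] by (rule eventually_mono[rotated]) auto
  moreover have "((\<lambda>R. B / R) \<longlongrightarrow> 0) at_top"
    by (rule tendsto_divide_0[OF tendsto_const filterlim_at_top_imp_at_infinity[OF filterlim_ident]])
  ultimately have "L \<le> 0"
    by (intro tendsto_lowerbound[of "\<lambda>R. B / R" 0 at_top L]) auto
  then show ?thesis using L unfolding Q_def by simp
qed

end

section \<open>Trajectories under random pair selection\<close>

text \<open>\<open>traj\<close> recurses on the last edge, whereas conditioning on the first edge
  needs the recursion from the front.\<close>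

lemma traj_shift:
  "traj c th x \<omega> (Suc t) = traj c th (upd_step c th (\<omega> 0) x) (\<lambda>n. \<omega> (Suc n)) t"
  by (induction t) auto

lemma space_pair_selection [simp]: "space (pair_selection E) = UNIV"
  by (simp add: pair_selection_def space_PiM PiE_UNIV_domain)

lemma prob_space_pair_selection: "prob_space (pair_selection E)"
  unfolding pair_selection_def by (intro prob_space_PiM prob_space_measure_pmf)

text \<open>The state at time \<open>t\<close> depends on finitely many edges from a finite type, so
  it is measurable even into the discrete sigma-algebra, and every set of states gives an
  event.\<close>

lemma traj_measurable [measurable]:
  fixes x :: "real ^ 'n::finite"
  shows "(\<lambda>\<omega>. traj c th x \<omega> t) \<in> measurable (pair_selection E) (count_space UNIV)"
proof (induction t)
  case (Suc t)
  have "(\<lambda>\<omega>. \<omega> t) \<in> measurable (pair_selection E) (measure_pmf (pmf_of_set E))"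
    unfolding pair_selection_def by (intro measurable_component_singleton) simp
  then have "(\<lambda>\<omega>. \<omega> t) \<in> measurable (pair_selection E) (count_space UNIV)"
    by simp
  moreover have "(\<lambda>\<omega>. upd_step c th e (traj c th x \<omega> t))
      \<in> measurable (pair_selection E) (count_space UNIV)" for e
    by (rule measurable_compose[OF Suc]) simp
  ultimately show ?case
    by (simp add: measurable_compose_countable)
qed simp

lemma traj_mem_sets [measurable]:
  fixes x :: "real ^ 'n::finite"
  shows "{\<omega>. traj c th x \<omega> t \<in> B} \<in> sets (pair_selection E)"
  using measurable_sets[OF traj_measurable, of B c th x t E] by (simp add: vimage_def)

text \<open>Induction by conditioning on the first edge: prepending an independent edge reproduces
  the product measure, and Fubini turns the outer integral into \<open>avg\<close>.\<close>

lemma prob_traj_eq_avg: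
  fixes x :: "real ^ 'n::finite"
  assumes "finite_choice E"
  shows "measure (pair_selection E) {\<omega>. traj c th x \<omega> t \<in> B} =
    (finite_choice.avg E (upd_step c th) ^^ t) (indicator B) x"
proof -
  interpret finite_choice E "upd_step c th" by fact
  let ?M = "measure_pmf (pmf_of_set E)"
  interpret sequence_space ?M
    by (simp add: sequence_space_def product_prob_space_def product_sigma_finite_def
        product_prob_space_axioms_def measure_pmf.sigma_finite_measure_axioms
        measure_pmf.prob_space_axioms)
  interpret paths: prob_space "pair_selection E" by (rule prob_space_pair_selection)
  have S: "S = pair_selection E" by (simp add: pair_selection_def)
  show ?thesis
  proof (induction t arbitrary: x)
    case 0
    then show ?case using paths.prob_space by (simp add: indicator_def)
  next
    case (Suc t)
    let ?Y = "{\<omega>. traj c th x \<omega> (Suc t) \<in> B}"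
    let ?f = "\<lambda>(s, \<omega>). case_nat s \<omega>"
    have f: "?f \<in> measurable (?M \<Otimes>\<^sub>M S) S" by measurable
    have "emeasure S ?Y = emeasure (distr (?M \<Otimes>\<^sub>M S) S ?f) ?Y"
      by (simp only: PiM_iter)
    also have "\<dots> = emeasure (?M \<Otimes>\<^sub>M S) (?f -` ?Y \<inter> space (?M \<Otimes>\<^sub>M S))"
      by (rule emeasure_distr[OF f]) (simp only: S traj_mem_sets)
    also have "\<dots> = (\<integral>\<^sup>+ s. emeasure S (Pair s -` (?f -` ?Y \<inter> space (?M \<Otimes>\<^sub>M S))) \<partial>?M)"
      by (intro P.emeasure_pair_measure_alt measurable_sets[OF f])
        (simp only: S traj_mem_sets)
    also have "\<dots> = (\<integral>\<^sup>+ s. ennreal ((avg ^^ t) (indicator B) (upd_step c th s x)) \<partial>?M)"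
    proof (intro nn_integral_cong)
      fix s
      have "Pair s -` (?f -` ?Y \<inter> space (?M \<Otimes>\<^sub>M S)) = {\<omega>. traj c th (upd_step c th s x) \<omega> t \<in> B}"
        by (auto simp: space_pair_measure S traj_shift simp del: traj.simps(2))
      then show "emeasure S (Pair s -` (?f -` ?Y \<inter> space (?M \<Otimes>\<^sub>M S)))
          = ennreal ((avg ^^ t) (indicator B) (upd_step c th s x))"
        by (simp add: S paths.emeasure_eq_measure Suc)
    qed
    also have "\<dots> = ennreal (\<integral> s. (avg ^^ t) (indicator B) (upd_step c th s x) \<partial>?M)"
      using fin nonempty
      by (intro nn_integral_eq_integral integrable_measure_pmf_finite)
        (auto simp: Suc[symmetric])
    also have "\<dots> = ennreal ((avg ^^ Suc t) (indicator B) x)"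
      using fin nonempty by (simp add: integral_pmf_of_set avg_def)
    finally have "ennreal (measure (pair_selection E) ?Y) = ennreal ((avg ^^ Suc t) (indicator B) x)"
      by (simp only: S paths.emeasure_eq_measure)
    \<comment> \<open>\<open>ennreal\<close> maps negative reals to 0, so stripping it requires
      nonnegative values.\<close>
    moreover have "0 \<le> (avg ^^ Suc t) (indicator B) x"
      using funpow_avg_mono[of UNIV "\<lambda>_. 0" "indicator B" x "Suc t"]
      by (simp add: funpow_avg_const del: funpow.simps)
    ultimately show ?case
      by simp
  qed
qed

section \<open>Opinion gap and absorption\<close>

lemma sat_bounds: "0 < c \<Longrightarrow> - c \<le> sat c z \<and> sat c z \<le> c"
  by (auto simp: sat_def)

lemma sat_id: "- c \<le> z \<Longrightarrow> z \<le> c \<Longrightarrow> sat c z = z"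
  by (auto simp: sat_def)

lemma sat_top: "0 < c \<Longrightarrow> c \<le> z \<Longrightarrow> sat c z = c"
  by (auto simp: sat_def)

lemma sat_bot: "0 < c \<Longrightarrow> z \<le> - c \<Longrightarrow> sat c z = - c"
  by (auto simp: sat_def)

lemma sat_move:
  assumes "- c \<le> a" "a \<le> c"
  shows "\<bar>sat c (a + t) - a\<bar> \<le> \<bar>t\<bar>"
  using assms by (auto simp: sat_def)

text \<open>The sign condition says that the shifts push \<open>a\<close> and \<open>b\<close>
  apart. If only one end is clipped, the other still moves away by the full
  \<open>\<bar>t\<bar>\<close>; if both are, they end up \<open>2 * c\<close> apart.\<close>

lemma sat_spread:
  assumes "0 < c" "- c \<le> a" "a \<le> c" "- c \<le> b" "b \<le> c" "0 \<le> t * (a - b)"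
  shows "min (2 * c) \<bar>t\<bar> \<le> \<bar>sat c (a + t) - sat c (b - t)\<bar>"
proof -
  have "0 \<le> t \<and> b \<le> a \<or> t \<le> 0 \<and> a \<le> b"
    using assms(6) by (auto simp: zero_le_mult_iff)
  then show ?thesis
    using assms(1-5) unfolding sat_def min_def by (smt (verit))
qed

lemma upd_step_pair:
  assumes "i \<noteq> j"
  shows "upd_step c th {i, j} x $ k =
    (if k = i then sat c (x $ i - th {i, j} * (x $ i - x $ j))
     else if k = j then sat c (x $ j + th {i, j} * (x $ i - x $ j))
     else x $ k)"
proof -
  have "(THE s. s \<in> {i, j} - {i}) = j" "(THE s. s \<in> {i, j} - {j}) = i"
    using assms by auto
  then show ?thesis
    using assms by (simp add: upd_step_def algebra_simps)
qed

text \<open>The bound \<open>1 / \<alpha> \<le> \<beta>\<close> enters twice: with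
  \<open>\<alpha> < 1/2\<close> it gives \<open>2 \<le> \<beta>\<close>, hence growth of the gap,
  and as \<open>1 \<le> \<alpha> * \<beta>\<close> it makes the last edge of
  \<open>align_node\<close> saturate.\<close>

locale repelling_dynamics =
  fixes c \<alpha> \<beta> :: real and V1 V2 :: "'n::finite set" and Ep En :: "'n set set"
  assumes c_pos: "0 < c"
    and complete: "complete_signed_graph UNIV Ep En"
    and balanced: "structurally_balanced UNIV Ep En V1 V2"
    and alpha: "0 < \<alpha>" "\<alpha> < 1/2"
    and beta: "1 / \<alpha> \<le> \<beta>"
begin

abbreviation "E \<equiv> Ep \<union> En"
abbreviation "step \<equiv> upd_step c (theta Ep \<alpha> \<beta>)"

text \<open>By completeness and balance, this holds exactly for the ends of a negative edge.\<close>

definition opp :: "'n \<Rightarrow> 'n \<Rightarrow> bool" where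
  "opp i j \<longleftrightarrow> (i \<in> V1) \<noteq> (j \<in> V1)"

definition box :: "(real ^ 'n) set" where
  "box = {x. \<forall>k. - c \<le> x $ k \<and> x $ k \<le> c}"

definition gap :: "real ^ 'n \<Rightarrow> real" where
  "gap x = Max ((\<lambda>(i, j). \<bar>x $ i - x $ j\<bar>) ` {(i, j). opp i j})"

definition \<kappa> :: real where
  "\<kappa> = min (1/2) (1 - 2 * \<alpha>)"

lemma beta_ge_2: "2 \<le> \<beta>"
proof -
  have "2 \<le> 1 / \<alpha>" using alpha by (simp add: field_simps)
  then show ?thesis using beta by linarith
qed

lemma alpha_beta: "1 \<le> \<alpha> * \<beta>"
  using alpha beta by (simp add: field_simps)

lemma kappa: "0 < \<kappa>" "\<kappa> \<le> 1/2" "\<kappa> \<le> 1 - 2 * \<alpha>" "\<kappa> < 1"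
  using alpha by (auto simp: \<kappa>_def min_def)

lemma V2_eq: "V2 = - V1"
  using balanced by (auto simp: structurally_balanced_def)

lemma E_eq: "E = {{i, j} | i j. i \<noteq> j}"
  using complete by (simp add: complete_signed_graph_def)

lemma pair_in_E: "i \<noteq> j \<Longrightarrow> {i, j} \<in> E"
  unfolding E_eq by blast

lemma E_cases:
  assumes "e \<in> E"
  obtains i j where "i \<noteq> j" "e = {i, j}"
  using assms unfolding E_eq by blast

lemma opp_neq: "opp i j \<Longrightarrow> i \<noteq> j"
  by (auto simp: opp_def)

lemma opp_sym: "opp i j \<Longrightarrow> opp j i"
  by (auto simp: opp_def)

lemma opp_exists: "\<exists>i j. opp i j"
proof -
  have "V1 \<noteq> {}" "V2 \<noteq> {}"
    using balanced by (simp_all add: structurally_balanced_def)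
  then show ?thesis
    unfolding V2_eq opp_def by blast
qed

lemma theta_opp:
  assumes "opp i j"
  shows "theta Ep \<alpha> \<beta> {i, j} = - \<beta>"
proof -
  have "{i, j} \<in> En"
  proof (cases "i \<in> V1")
    case True
    then show ?thesis
      using balanced pair_in_E[OF opp_neq[OF assms]] assms V2_eq
      unfolding structurally_balanced_def opp_def by blast
  next
    case False
    then have "j \<in> V1" "i \<in> V2" "{j, i} \<in> E"
      using pair_in_E[OF opp_neq[OF opp_sym[OF assms]]] assms V2_eq by (auto simp: opp_def)
    then have "{j, i} \<in> En"
      using balanced unfolding structurally_balanced_def by blast
    then show ?thesis by (simp add: insert_commute)
  qed
  then show ?thesis
    using complete by (auto simp: theta_def complete_signed_graph_def)
qed

lemma theta_same:
  assumes "i \<noteq> j" "\<not> opp i j"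
  shows "theta Ep \<alpha> \<beta> {i, j} = \<alpha>"
proof -
  have "(i \<in> V1 \<and> j \<in> V1) \<or> (i \<in> V2 \<and> j \<in> V2)"
    using assms(2) V2_eq by (auto simp: opp_def)
  then have "{i, j} \<in> Ep"
    using balanced pair_in_E[OF assms(1)] unfolding structurally_balanced_def by blast
  then show ?thesis by (simp add: theta_def)
qed

lemma step_opp:
  assumes "opp i j"
  shows "step {i, j} x $ k =
    (if k = i then sat c (x $ i + \<beta> * (x $ i - x $ j))
     else if k = j then sat c (x $ j - \<beta> * (x $ i - x $ j))
     else x $ k)"
  using upd_step_pair[OF opp_neq[OF assms], of c "theta Ep \<alpha> \<beta>" x k]
  by (simp add: theta_opp[OF assms])

lemma average_in_interval:
  assumes "- c \<le> a" "a \<le> c" "- c \<le> b" "b \<le> c"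
  shows "- c \<le> a - \<alpha> * (a - b)" "a - \<alpha> * (a - b) \<le> c"
proof -
  have "0 \<le> (1 - \<alpha>) * (a + c)" "0 \<le> \<alpha> * (b + c)" "0 \<le> (1 - \<alpha>) * (c - a)" "0 \<le> \<alpha> * (c - b)"
    using assms alpha by auto
  then show "- c \<le> a - \<alpha> * (a - b)" "a - \<alpha> * (a - b) \<le> c"
    by (auto simp: algebra_simps)
qed

lemma step_same:
  assumes "i \<noteq> j" "\<not> opp i j" "x \<in> box"
  shows "step {i, j} x $ k =
    (if k = i then x $ i - \<alpha> * (x $ i - x $ j)
     else if k = j then x $ j - \<alpha> * (x $ j - x $ i)
     else x $ k)"
proof -
  have b: "- c \<le> x $ k" "x $ k \<le> c" for k
    using assms(3) by (auto simp: box_def)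
  have "sat c (x $ i - \<alpha> * (x $ i - x $ j)) = x $ i - \<alpha> * (x $ i - x $ j)"
    "sat c (x $ j - \<alpha> * (x $ j - x $ i)) = x $ j - \<alpha> * (x $ j - x $ i)"
    by (intro sat_id average_in_interval b)+
  moreover have "x $ j + \<alpha> * (x $ i - x $ j) = x $ j - \<alpha> * (x $ j - x $ i)"
    by (simp add: algebra_simps)
  ultimately show ?thesis
    using upd_step_pair[OF assms(1), of c "theta Ep \<alpha> \<beta>" x k]
    by (simp add: theta_same[OF assms(1,2)])
qed

lemma step_box:
  assumes "x \<in> box"
  shows "step e x \<in> box"
  using assms sat_bounds[OF c_pos] by (auto simp: box_def upd_step_def)

lemma fold_step_box: "x \<in> box \<Longrightarrow> fold step es x \<in> box"
  by (induction es arbitrary: x) (auto intro: step_box)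

section \<open>Effect of one edge on the gap between the two sides\<close>

lemma gap_ge:
  assumes "opp i j"
  shows "\<bar>x $ i - x $ j\<bar> \<le> gap x"
  unfolding gap_def using assms by (intro Max_ge) (auto intro: finite_subset[OF subset_UNIV])

lemma gap_attained:
  obtains i j where "opp i j" "gap x = \<bar>x $ i - x $ j\<bar>"
proof -
  have "gap x \<in> (\<lambda>(i, j). \<bar>x $ i - x $ j\<bar>) ` {(i, j). opp i j}"
    unfolding gap_def using opp_exists
    by (intro Max_in) (auto intro: finite_subset[OF subset_UNIV])
  then show ?thesis using that by auto
qed

lemma gap_nonneg: "0 \<le> gap x"
  by (rule gap_attained[of x]) auto

lemma gap_le:
  assumes "x \<in> box"
  shows "gap x \<le> 2 * c"
proof -
  obtain i j where "gap x = \<bar>x $ i - x $ j\<bar>" by (rule gap_attained)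
  moreover have "- c \<le> x $ i" "x $ i \<le> c" "- c \<le> x $ j" "x $ j \<le> c"
    using assms by (auto simp: box_def)
  ultimately show ?thesis by linarith
qed

lemma gap_step_opp:
  assumes "x \<in> box" "opp i j"
  shows "min (2 * c) (\<beta> * \<bar>x $ i - x $ j\<bar>) \<le> gap (step {i, j} x)"
proof -
  have "0 \<le> \<beta> * (x $ i - x $ j) * (x $ i - x $ j)"
    using beta_ge_2 by (simp add: mult.assoc)
  then have "min (2 * c) \<bar>\<beta> * (x $ i - x $ j)\<bar>
      \<le> \<bar>step {i, j} x $ i - step {i, j} x $ j\<bar>"
    using assms opp_neq[OF assms(2)] c_pos
    by (simp add: step_opp sat_spread box_def)
  also have "\<dots> \<le> gap (step {i, j} x)"
    by (rule gap_ge[OF assms(2)])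
  finally show ?thesis
    using beta_ge_2 by (simp add: abs_mult)
qed

text \<open>The new difference between \<open>i\<close> and \<open>j\<close> is \<open>(1 -
  \<alpha>) * (x $ i - x $ j) + \<alpha> * (x $ k - x $ j)\<close>. As \<open>k\<close> and
  \<open>j\<close> are also on opposite sides, the second term costs at most
  \<open>\<alpha> * gap x\<close>.\<close>

lemma gap_step_same:
  assumes x: "x \<in> box" and "i \<noteq> k" "\<not> opp i k" "opp i j" and max: "gap x = \<bar>x $ i - x $ j\<bar>"
  shows "(1 - 2 * \<alpha>) * gap x \<le> gap (step {i, k} x)"
proof -
  have kj: "opp k j" using assms by (auto simp: opp_def)
  then have j: "j \<noteq> i" "j \<noteq> k" using opp_neq assms by blast+
  have "\<bar>x $ k - x $ j\<bar> \<le> gap x" by (rule gap_ge[OF kj])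
  then have "\<alpha> * \<bar>x $ k - x $ j\<bar> \<le> \<alpha> * gap x"
    using alpha by simp
  moreover have "(1 - \<alpha>) * \<bar>x $ i - x $ j\<bar> = (1 - \<alpha>) * gap x" by (simp add: max)
  ultimately have "(1 - 2 * \<alpha>) * gap x \<le> (1 - \<alpha>) * \<bar>x $ i - x $ j\<bar> - \<alpha> * \<bar>x $ k - x $ j\<bar>"
    by (simp add: algebra_simps)
  also have "\<dots> = \<bar>(1 - \<alpha>) * (x $ i - x $ j)\<bar> - \<bar>\<alpha> * (x $ k - x $ j)\<bar>"
    using alpha by (simp add: abs_mult)
  also have "\<dots> \<le> \<bar>(1 - \<alpha>) * (x $ i - x $ j) + \<alpha> * (x $ k - x $ j)\<bar>"
    by linarith
  also have "\<dots> = \<bar>step {i, k} x $ i - step {i, k} x $ j\<bar>"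
    using j assms by (simp add: step_same algebra_simps)
  also have "\<dots> \<le> gap (step {i, k} x)"
    by (rule gap_ge[OF \<open>opp i j\<close>])
  finally show ?thesis .
qed

text \<open>For a positive gap, a cross edge either pushes by more than half the gap and so leaves
  at least that much, or pushes so little that its ends are not an extremal pair; then at most one
  extremal node moves, by at most half the gap. An edge inside a side falls under
  \<open>gap_step_same\<close> or misses the extremal pair.\<close>

lemma gap_step_ge:
  assumes x: "x \<in> box" and "e \<in> E"
  shows "\<kappa> * gap x \<le> gap (step e x)"
proof -
  obtain a b where ab: "a \<noteq> b" "e = {a, b}" using \<open>e \<in> E\<close> by (rule E_cases)
  obtain i j where ij: "opp i j" "gap x = \<bar>x $ i - x $ j\<bar>" by (rule gap_attained)
  have ji: "opp j i" "gap x = \<bar>x $ j - x $ i\<bar>" using ij opp_sym by auto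
  show ?thesis
  proof (cases "opp a b")
    case True
    have half: "\<kappa> * gap x \<le> gap x / 2"
      using mult_right_mono[OF kappa(2) gap_nonneg[of x]] by simp
    show ?thesis
    proof (cases "\<beta> * \<bar>x $ a - x $ b\<bar> \<le> gap x / 2")
      case small: True
      have b: "- c \<le> x $ k" "x $ k \<le> c" for k
        using x by (auto simp: box_def)
      have move: "\<bar>step {a, b} x $ k - x $ k\<bar> \<le> gap x / 2" for k
        using small sat_move[OF b, of a "\<beta> * (x $ a - x $ b)"]
          sat_move[OF b, of b "- \<beta> * (x $ a - x $ b)"] gap_nonneg[of x] beta_ge_2
        by (simp add: step_opp[OF True] abs_mult)
      show ?thesis
      proof (cases "gap x = 0")
        case True
        then show ?thesis using gap_nonneg by simp
      next
        case False
        have "2 * \<bar>x $ a - x $ b\<bar> \<le> gap x / 2"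
          using small mult_right_mono[OF beta_ge_2, of "\<bar>x $ a - x $ b\<bar>"] by simp
        moreover have "0 < gap x" using False gap_nonneg[of x] by simp
        ultimately have "\<bar>x $ a - x $ b\<bar> < gap x" by simp
        then have "{i, j} \<noteq> {a, b}"
          using ij(2) by (auto simp: doubleton_eq_iff abs_minus_commute)
        then have "i \<notin> {a, b} \<or> j \<notin> {a, b}"
          using opp_neq[OF ij(1)] by auto
        then have "step {a, b} x $ i = x $ i \<or> step {a, b} x $ j = x $ j"
          by (auto simp: step_opp[OF True])
        then have "gap x / 2 \<le> \<bar>step {a, b} x $ i - step {a, b} x $ j\<bar>"
          using move[of i] move[of j] ij(2) by linarith
        also have "\<dots> \<le> gap (step e x)"
          using gap_ge[OF ij(1)] ab by simp
        finally show ?thesis using half by linarith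
      qed
    next
      case False
      then show ?thesis
        using half gap_step_opp[OF x True] gap_le[OF x] c_pos ab by (simp add: min_def split: if_splits)
    qed
  next
    case False
    then have "\<not> opp b a" by (auto simp: opp_def)
    have *: "\<kappa> * gap x \<le> (1 - 2 * \<alpha>) * gap x"
      by (intro mult_right_mono kappa gap_nonneg)
    consider "i = a" | "i = b" | "j = a" | "j = b" | "i \<notin> {a, b}" "j \<notin> {a, b}" by blast
    then show ?thesis
    proof cases
      case 1
      show ?thesis
        using * gap_step_same[OF x ab(1) False ij[unfolded 1]] unfolding ab(2) by (rule order_trans)
    next
      case 2
      show ?thesis
        using * gap_step_same[OF x ab(1)[symmetric] \<open>\<not> opp b a\<close> ij[unfolded 2]]
        unfolding ab(2) insert_commute[of b a] by (rule order_trans)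
    next
      case 3
      show ?thesis
        using * gap_step_same[OF x ab(1) False ji[unfolded 3]] unfolding ab(2) by (rule order_trans)
    next
      case 4
      show ?thesis
        using * gap_step_same[OF x ab(1)[symmetric] \<open>\<not> opp b a\<close> ji[unfolded 4]]
        unfolding ab(2) insert_commute[of b a] by (rule order_trans)
    next
      case 5
      then have "gap x = \<bar>step e x $ i - step e x $ j\<bar>"
        using ij ab False x by (simp add: step_same)
      also have "\<dots> \<le> gap (step e x)" by (rule gap_ge[OF ij(1)])
      finally show ?thesis
        using mult_right_mono[OF less_imp_le[OF kappa(4)] gap_nonneg[of x]] by linarith
    qed
  qed
qed

lemma finite_choice_E: "finite_choice E"
proof
  show "finite E" by simp
  obtain i j where "opp i j" using opp_exists by blast
  then have "{i, j} \<in> E" by (rule pair_in_E[OF opp_neq])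
  then show "E \<noteq> {}" by (metis empty_iff)
qed

text \<open>Each time the cross edge realising the current gap is chosen, which at least doubles the
  gap up to the cap. The cap in the bound allows words of length exactly \<open>k\<close>, whenever
  saturation occurs.\<close>

lemma gap_growth:
  assumes "x \<in> box"
  shows "\<exists>es. length es = k \<and> set es \<subseteq> E \<and> min (2 * c) (2 ^ k * gap x) \<le> gap (fold step es x)"
proof (induction k)
  case (Suc k)
  then obtain es where es: "length es = k" "set es \<subseteq> E"
    "min (2 * c) (2 ^ k * gap x) \<le> gap (fold step es x)" by blast
  let ?y = "fold step es x"
  obtain i j where ij: "opp i j" "gap ?y = \<bar>?y $ i - ?y $ j\<bar>" by (rule gap_attained)
  have "2 * gap ?y \<le> \<beta> * gap ?y"
    using beta_ge_2 gap_nonneg by (rule mult_right_mono)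
  then have "min (2 * c) (2 ^ Suc k * gap x) \<le> min (2 * c) (\<beta> * gap ?y)"
    using es(3) c_pos unfolding min_def power_Suc mult.assoc by (smt (verit))
  also have "\<dots> \<le> gap (fold step (es @ [{i, j}]) x)"
    using gap_step_opp[OF fold_step_box[OF assms] ij(1)] ij(2) by simp
  finally show ?case
    using es pair_in_E[OF opp_neq[OF ij(1)]] by (intro exI[of _ "es @ [{i, j}]"]) auto
qed (auto intro: gap_nonneg)

section \<open>Polarized states and words leading to them\<close>

definition target :: "real \<Rightarrow> 'n \<Rightarrow> real" where
  "target \<tau> k = (if k \<in> V1 then \<tau> else - \<tau>)"

definition polarized :: "(real ^ 'n) set" where
  "polarized = {x. \<exists>\<tau>\<in>{-c, c}. \<forall>k. x $ k = target \<tau> k}"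

text \<open>A cross edge pushes both ends beyond their extremes and clipping restores them; inside a
  side the two ends agree.\<close>

lemma step_polarized:
  assumes "x \<in> polarized" "e \<in> E"
  shows "step e x = x"
proof -
  obtain \<tau> where \<tau>: "\<tau> = - c \<or> \<tau> = c" "\<And>k. x $ k = target \<tau> k"
    using assms(1) by (auto simp: polarized_def)
  then have box: "x \<in> box"
    using c_pos by (auto simp: box_def target_def)
  obtain i j where ij: "i \<noteq> j" "e = {i, j}" using assms(2) by (rule E_cases)
  have "step {i, j} x $ k = x $ k" for k
  proof (cases "opp i j")
    case True
    have ext: "sat c (\<sigma> + \<beta> * (2 * \<sigma>)) = \<sigma>" if "\<sigma> = - c \<or> \<sigma> = c" for \<sigma>
    proof -
      have "0 \<le> \<beta> * (2 * c)" using c_pos beta_ge_2 by simp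
      then show ?thesis using that c_pos by (auto intro: sat_top sat_bot)
    qed
    have xj: "x $ j = - x $ i" and xi: "x $ i = - c \<or> x $ i = c"
      using True \<tau> by (auto simp: target_def opp_def)
    have "sat c (x $ i + \<beta> * (x $ i - x $ j)) = x $ i"
      using ext[OF xi] by (simp add: xj)
    moreover have "sat c (x $ j - \<beta> * (x $ i - x $ j)) = x $ j"
      using ext[of "x $ j"] xi by (auto simp: xj)
    ultimately show ?thesis
      by (simp add: step_opp[OF True])
  next
    case False
    then show ?thesis
      using \<tau> ij by (auto simp: step_same box target_def opp_def)
  qed
  then show ?thesis by (simp add: vec_eq_iff ij)
qed

text \<open>The first edge moves \<open>k\<close> away from the wrong extreme, where the edge \<open>{o', k}\<close> has
  no effect, at the price of displacing \<open>m\<close>; the second edge restores \<open>m\<close>.\<close>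
lemma align_node:
  assumes x: "x \<in> box" and \<tau>: "\<tau> \<in> {-c, c}" and km: "k \<noteq> m" "\<not> opp k m" and mo: "opp m o'"
    and xm: "x $ m = target \<tau> m" and xo: "x $ o' = target \<tau> o'"
  shows "fold step [{k, m}, {m, o'}, {o', k}] x $ l =
    (if l \<in> {k, m, o'} then target \<tau> l else x $ l)"
proof -
  define \<sigma> where "\<sigma> = target \<tau> m"
  have \<sigma>: "\<sigma> = - c \<or> \<sigma> = c" using \<tau> by (auto simp: \<sigma>_def target_def)
  have tgt: "target \<tau> k = \<sigma>" "target \<tau> o' = - \<sigma>"
    using km mo by (auto simp: \<sigma>_def target_def opp_def)
  have ok: "opp o' k" using km mo by (auto simp: opp_def)
  have neq: "m \<noteq> o'" "o' \<noteq> k" using opp_neq mo ok by blast+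
  have xk: "- c \<le> x $ k" "x $ k \<le> c" using x by (auto simp: box_def)
  \<comment> \<open>The error of node \<open>k\<close>; it equals \<open>2 * \<sigma>\<close> when
    \<open>k\<close> sits at the wrong extreme.\<close>
  define d where "d = \<sigma> - x $ k"
  have d: "\<sigma> = c \<and> 0 \<le> d \<and> d \<le> 2 * c \<or> \<sigma> = - c \<and> - 2 * c \<le> d \<and> d \<le> 0"
    using \<sigma> xk c_pos by (auto simp: d_def)
  define x1 where "x1 = step {k, m} x"
  define x2 where "x2 = step {m, o'} x1"
  define x3 where "x3 = step {o', k} x2"
  have x1: "x1 $ l = (if l = k then \<sigma> - (1 - \<alpha>) * d else if l = m then \<sigma> - \<alpha> * d else x $ l)" for l
    unfolding x1_def using km xm by (simp add: step_same x d_def \<sigma>_def[symmetric] algebra_simps)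
  have bd: "0 \<le> r * d" "r * d \<le> r * (2 * c)" if "0 \<le> r" "\<sigma> = c" for r
    using that d c_pos by (auto intro!: mult_left_mono)
  have bd': "r * d \<le> 0" "r * (- 2 * c) \<le> r * d" if "0 \<le> r" "\<sigma> = - c" for r
    using that d mult_left_mono[of "- 2 * c" d r] by (auto simp: mult_nonneg_nonpos)
  have \<alpha>c: "\<alpha> * (2 * c) < c" using alpha c_pos by simp
  have x2m: "x2 $ m = sat c (\<sigma> - \<alpha> * d + \<beta> * (2 * \<sigma> - \<alpha> * d))"
    and x2o: "x2 $ o' = sat c (- \<sigma> - \<beta> * (2 * \<sigma> - \<alpha> * d))"
    using mo neq km xo tgt by (simp_all add: x2_def step_opp x1)
  have x2k: "x2 $ k = \<sigma> - (1 - \<alpha>) * d"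
    using mo neq km by (simp add: x2_def step_opp x1)
  \<comment> \<open>Second edge: its ends differ by \<open>2 * \<sigma> - \<alpha> * d\<close> with
    \<open>\<bar>\<alpha> * d\<bar> < c\<close>, hence by at least \<open>c\<close>, so
    \<open>2 \<le> \<beta>\<close> gives a push of at least \<open>2 * c\<close>, saturating both
    ends.\<close>
  have x2: "x2 $ m = \<sigma> \<and> x2 $ o' = - \<sigma>"
    using \<sigma>
  proof
    assume \<sigma>c: "\<sigma> = c"
    have "c \<le> 2 * \<sigma> - \<alpha> * d" using bd[of \<alpha>] \<sigma>c alpha \<alpha>c by linarith
    then have "2 * c \<le> \<beta> * (2 * \<sigma> - \<alpha> * d)"
      using beta_ge_2 c_pos by (intro mult_mono) auto
    moreover have "\<alpha> * d \<le> c" using bd[of \<alpha>] \<sigma>c alpha \<alpha>c by linarith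
    ultimately have "c \<le> \<sigma> - \<alpha> * d + \<beta> * (2 * \<sigma> - \<alpha> * d)" "- \<sigma> - \<beta> * (2 * \<sigma> - \<alpha> * d) \<le> - c"
      using \<sigma>c c_pos by linarith+
    then show ?thesis
      unfolding x2m x2o using c_pos by (simp only: sat_top sat_bot \<sigma>c minus_minus)
  next
    assume \<sigma>c: "\<sigma> = - c"
    have "c \<le> - (2 * \<sigma> - \<alpha> * d)" using bd'[of \<alpha>] \<sigma>c alpha \<alpha>c by linarith
    then have "2 * c \<le> \<beta> * - (2 * \<sigma> - \<alpha> * d)"
      using beta_ge_2 c_pos by (intro mult_mono) auto
    moreover have "- c \<le> \<alpha> * d" using bd'[of \<alpha>] \<sigma>c alpha \<alpha>c by linarith
    ultimately have "\<sigma> - \<alpha> * d + \<beta> * (2 * \<sigma> - \<alpha> * d) \<le> - c" "c \<le> - \<sigma> - \<beta> * (2 * \<sigma> - \<alpha> * d)"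
      using \<sigma>c c_pos by linarith+
    then show ?thesis
      unfolding x2m x2o using c_pos by (simp only: sat_top sat_bot \<sigma>c minus_minus)
  qed
  have diff: "x2 $ o' - x2 $ k = - (2 * \<sigma> - (1 - \<alpha>) * d)"
    using x2 x2k by simp
  have "x3 $ o' = sat c (x2 $ o' + \<beta> * (x2 $ o' - x2 $ k))"
    and "x3 $ k = sat c (x2 $ k - \<beta> * (x2 $ o' - x2 $ k))"
    using ok neq by (simp_all add: x3_def step_opp)
  then have x3o: "x3 $ o' = sat c (- \<sigma> - \<beta> * (2 * \<sigma> - (1 - \<alpha>) * d))"
    and x3k: "x3 $ k = sat c (\<sigma> - (1 - \<alpha>) * d + \<beta> * (2 * \<sigma> - (1 - \<alpha>) * d))"
    unfolding diff unfolding x2k x2[THEN conjunct2] by (simp_all add: algebra_simps)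
  \<comment> \<open>Third edge: its ends differ by at least \<open>2 * \<alpha> * c\<close>,
    attained for \<open>d = 2 * \<sigma>\<close>; \<open>1 \<le> \<alpha> * \<beta>\<close> turns
    this into a saturating push.\<close>
  have \<alpha>\<beta>c: "2 * c \<le> \<beta> * (2 * \<alpha> * c)"
    using alpha_beta c_pos mult_right_mono[OF alpha_beta, of "2 * c"] by (simp add: algebra_simps)
  have x3: "x3 $ o' = - \<sigma> \<and> x3 $ k = \<sigma>"
    using \<sigma>
  proof
    assume \<sigma>c: "\<sigma> = c"
    have "2 * \<alpha> * c \<le> 2 * \<sigma> - (1 - \<alpha>) * d"
      using bd[of "1 - \<alpha>"] \<sigma>c alpha by (simp add: algebra_simps)
    then have "2 * c \<le> \<beta> * (2 * \<sigma> - (1 - \<alpha>) * d)"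
      using \<alpha>\<beta>c beta_ge_2 by (smt (verit) mult_left_mono)
    moreover have "- c \<le> \<sigma> - (1 - \<alpha>) * d"
      using bd[of "1 - \<alpha>"] \<sigma>c alpha c_pos mult_pos_pos[OF alpha(1) c_pos]
      by (simp add: algebra_simps)
    ultimately have "- \<sigma> - \<beta> * (2 * \<sigma> - (1 - \<alpha>) * d) \<le> - c"
      "c \<le> \<sigma> - (1 - \<alpha>) * d + \<beta> * (2 * \<sigma> - (1 - \<alpha>) * d)"
      using \<sigma>c c_pos by linarith+
    then show ?thesis
      unfolding x3o x3k using c_pos by (simp only: sat_top sat_bot \<sigma>c minus_minus)
  next
    assume \<sigma>c: "\<sigma> = - c"
    have "2 * \<alpha> * c \<le> - (2 * \<sigma> - (1 - \<alpha>) * d)"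
      using bd'[of "1 - \<alpha>"] \<sigma>c alpha by (simp add: algebra_simps)
    then have "2 * c \<le> \<beta> * - (2 * \<sigma> - (1 - \<alpha>) * d)"
      using \<alpha>\<beta>c beta_ge_2 by (smt (verit) mult_left_mono)
    moreover have "\<sigma> - (1 - \<alpha>) * d \<le> c"
      using bd'[of "1 - \<alpha>"] \<sigma>c alpha c_pos mult_pos_pos[OF alpha(1) c_pos]
      by (simp add: algebra_simps)
    ultimately have "c \<le> - \<sigma> - \<beta> * (2 * \<sigma> - (1 - \<alpha>) * d)"
      "\<sigma> - (1 - \<alpha>) * d + \<beta> * (2 * \<sigma> - (1 - \<alpha>) * d) \<le> - c"
      using \<sigma>c c_pos by linarith+
    then show ?thesis
      unfolding x3o x3k using c_pos by (simp only: sat_top sat_bot \<sigma>c minus_minus)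
  qed
  have "x3 $ l = x2 $ l" if "l \<noteq> o'" "l \<noteq> k" for l
    using that ok by (simp add: x3_def step_opp)
  moreover have "x2 $ l = x1 $ l" if "l \<noteq> m" "l \<noteq> o'" for l
    using that mo by (simp add: x2_def step_opp)
  ultimately have "x3 $ l = (if l \<in> {k, m, o'} then target \<tau> l else x $ l)"
    using x2 x3 x1[of l] tgt \<sigma>_def neq km by auto
  then show ?thesis by (simp add: x1_def x2_def x3_def)
qed

text \<open>Nodes are corrected one at a time with three edges each, the extremal pair
  \<open>i\<close>, \<open>j\<close> serving as reference; each round leaves the aligned nodes at
  their targets.\<close>

lemma align_nodes:
  assumes x: "x \<in> box" and \<tau>: "\<tau> \<in> {-c, c}" and ij: "opp i j"
    and xi: "x $ i = target \<tau> i" and xj: "x $ j = target \<tau> j"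
    and B: "finite B" "i \<notin> B" "j \<notin> B"
  shows "\<exists>es. length es = 3 * card B \<and> set es \<subseteq> E \<and>
    (\<forall>l\<in>insert i (insert j B). fold step es x $ l = target \<tau> l)"
  using B
proof (induction B rule: finite_induct)
  case empty
  then show ?case using xi xj by (intro exI[of _ "[]"]) auto
next
  case (insert k B)
  then obtain es where es: "length es = 3 * card B" "set es \<subseteq> E"
    "\<forall>l\<in>insert i (insert j B). fold step es x $ l = target \<tau> l" by auto
  \<comment> \<open>\<open>m\<close> is the one of \<open>i\<close>, \<open>j\<close> on the side of
    \<open>k\<close>, and \<open>o'\<close> is the other.\<close>
  obtain m o' where mo: "opp m o'" "\<not> opp k m" "k \<noteq> m" "k \<noteq> o'" "m \<in> {i, j}" "o' \<in> {i, j}"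
  proof (cases "opp k i")
    case True
    then show ?thesis using ij insert.prems that[of j i] by (auto simp: opp_def)
  next
    case False
    then show ?thesis using ij insert.prems that[of i j] by (auto simp: opp_def)
  qed
  let ?es = "[{k, m}, {m, o'}, {o', k}]"
  have "fold step ?es (fold step es x) $ l =
      (if l \<in> {k, m, o'} then target \<tau> l else fold step es x $ l)" for l
    by (rule align_node) (use es mo \<tau> fold_step_box[OF x] in auto)
  moreover have "set ?es \<subseteq> E"
    using mo opp_neq[OF mo(1)] pair_in_E by auto
  ultimately show ?case
    using es insert by (intro exI[of _ "es @ ?es"]) auto
qed

text \<open>The first \<open>k\<close> edges raise the gap to \<open>2 * c\<close>, which puts a
  pair at opposite extremes; the others are then aligned. The length is the same for all states
  meeting the bound, as \<open>survival_tendsto_0\<close> requires.\<close>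

lemma reach_polarized:
  assumes x: "x \<in> box" and large: "2 * c \<le> 2 ^ k * gap x"
  shows "\<exists>es. length es = k + 3 * (CARD('n) - 2) \<and> set es \<subseteq> E \<and> fold step es x \<in> polarized"
proof -
  obtain es where es: "length es = k" "set es \<subseteq> E" "2 * c \<le> gap (fold step es x)"
    using gap_growth[OF x, of k] large by auto
  define y where "y = fold step es x"
  have y: "y \<in> box" unfolding y_def by (rule fold_step_box[OF x])
  obtain i j where ij: "opp i j" "gap y = \<bar>y $ i - y $ j\<bar>" by (rule gap_attained)
  have "- c \<le> y $ i" "y $ i \<le> c" "- c \<le> y $ j" "y $ j \<le> c"
    using y by (auto simp: box_def)
  then have "y $ i = c \<and> y $ j = - c \<or> y $ i = - c \<and> y $ j = c"
    using ij(2) es(3) unfolding y_def[symmetric] by linarith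
  then obtain \<tau> where \<tau>: "\<tau> \<in> {-c, c}" "y $ i = target \<tau> i" "y $ j = target \<tau> j"
    using ij(1) that[of c] that[of "- c"] by (auto simp: target_def opp_def)
  have card: "card (UNIV - {i, j}) = CARD('n) - 2"
    using opp_neq[OF ij(1)] by (simp add: card_Diff_subset)
  have UN: "insert i (insert j (UNIV - {i, j})) = UNIV" by auto
  obtain es' where es': "length es' = 3 * (CARD('n) - 2)" "set es' \<subseteq> E"
    "\<forall>l. fold step es' y $ l = target \<tau> l"
    using align_nodes[OF y \<tau>(1) ij(1) \<tau>(2,3), of "UNIV - {i, j}"] unfolding card UN by auto
  then have "fold step (es @ es') x \<in> polarized"
    using \<tau>(1) by (auto simp: polarized_def y_def)
  then show ?thesis
    using es es' by (intro exI[of _ "es @ es'"]) auto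
qed

section \<open>Drift of a negative power of the gap and almost sure absorption\<close>

lemma gap_powr_drift:
  assumes x: "x \<in> box" "0 < gap x" and s: "0 < s"
  shows "finite_choice.avg E step (\<lambda>x. gap x powr - s) x \<le>
    (1 / card E * \<beta> powr - s + (1 - 1 / card E) * \<kappa> powr - s) * gap x powr - s
    + (2 * c) powr - s"
proof -
  interpret finite_choice E step by (rule finite_choice_E)
  have m: "0 \<le> 1 / real (card E)" "1 / real (card E) \<le> 1"
    using card_pos by simp_all
  obtain i j where ij: "opp i j" "gap x = \<bar>x $ i - x $ j\<bar>" by (rule gap_attained)
  \<comment> \<open>A negative power reverses the lower bound on the gap, and the power of the
    minimum is at most the sum of the two powers. The capped one becomes the additive constant of
    the drift.\<close>
  have good: "gap (step {i, j} x) powr - s \<le> (2 * c) powr - s + \<beta> powr - s * gap x powr - s"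
  proof -
    have "gap (step {i, j} x) powr - s \<le> (min (2 * c) (\<beta> * gap x)) powr - s"
      using gap_step_opp[OF x(1) ij(1)] ij(2) c_pos x(2) beta_ge_2 s
      by (intro powr_mono2') auto
    also have "\<dots> \<le> (2 * c) powr - s + (\<beta> * gap x) powr - s"
      by (simp add: min_def)
    finally show ?thesis
      using x(2) beta_ge_2 by (simp add: powr_mult)
  qed
  have bad: "gap (step e x) powr - s \<le> \<kappa> powr - s * gap x powr - s" if "e \<in> E" for e
  proof -
    have "gap (step e x) powr - s \<le> (\<kappa> * gap x) powr - s"
      using gap_step_ge[OF x(1) that] kappa(1) x(2) s by (intro powr_mono2') auto
    then show ?thesis
      using x(2) kappa(1) by (simp add: powr_mult)
  qed
  have "avg (\<lambda>x. gap x powr - s) x \<le>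
      1 / card E * ((2 * c) powr - s + \<beta> powr - s * gap x powr - s)
      + (1 - 1 / card E) * (\<kappa> powr - s * gap x powr - s)"
    using pair_in_E[OF opp_neq[OF ij(1)]] good bad by (rule avg_le_one_good)
  also have "\<dots> = (1 / card E * \<beta> powr - s + (1 - 1 / card E) * \<kappa> powr - s) * gap x powr - s
      + 1 / card E * (2 * c) powr - s"
    by (simp add: algebra_simps)
  also have "\<dots> \<le> (1 / card E * \<beta> powr - s + (1 - 1 / card E) * \<kappa> powr - s) * gap x powr - s
      + (2 * c) powr - s"
    using m by (intro add_left_mono mult_left_le_one_le) auto
  finally show ?thesis .
qed

text \<open>The box states with positive gap form an invariant set, since every edge retains a
  fraction \<open>\<kappa>\<close> of the gap.\<close>

lemma nonpolarized_prob_tendsto_0: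
  assumes x: "x \<in> box" "0 < gap x" and s: "0 < s"
    and rate: "1 / card E * \<beta> powr - s + (1 - 1 / card E) * \<kappa> powr - s < 1"
  shows "(\<lambda>t. measure (pair_selection E) {\<omega>. traj c (theta Ep \<alpha> \<beta>) x \<omega> t \<in> - polarized}) \<longlonglongrightarrow> 0"
proof -
  interpret finite_choice E step by (rule finite_choice_E)
  define \<rho> where "\<rho> = 1 / card E * \<beta> powr - s + (1 - 1 / card E) * \<kappa> powr - s"
  have "0 \<le> \<rho>" unfolding \<rho>_def using card_pos by simp
  have "(\<lambda>t. (avg ^^ t) (indicator (- polarized)) x) \<longlonglongrightarrow> 0"
  proof (rule survival_tendsto_0[where X = "{x \<in> box. 0 < gap x}" and g = "\<lambda>x. gap x powr - s"
        and \<rho> = \<rho> and K = "(2 * c) powr - s"])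
    show "step e y \<in> {x \<in> box. 0 < gap x}" if "y \<in> {x \<in> box. 0 < gap x}" "e \<in> E" for y e
      using that step_box[of y e] gap_step_ge[of y e] mult_pos_pos[OF kappa(1), of "gap y"] by auto
    show "step e y \<in> polarized" if "y \<in> polarized" "e \<in> E" for y e
      using that step_polarized by simp
    show "avg (\<lambda>x. gap x powr - s) y \<le> \<rho> * gap y powr - s + (2 * c) powr - s"
      if "y \<in> {x \<in> box. 0 < gap x}" for y
      using that gap_powr_drift[OF _ _ s] by (simp add: \<rho>_def)
    show "\<exists>T. \<forall>y\<in>{x \<in> box. 0 < gap x}. gap y powr - s \<le> R \<longrightarrow>
        (\<exists>es. length es = T \<and> set es \<subseteq> E \<and> fold step es y \<in> polarized)" for R
    proof -
      \<comment> \<open>Solves \<open>\<delta> powr - s = max R 1\<close>, so a bound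
        \<open>R\<close> on the power means a gap of at least \<open>\<delta>\<close>;
        \<open>max\<close> keeps the base positive for every real \<open>R\<close>.\<close>
      define \<delta> where "\<delta> = max R 1 powr (- 1 / s)"
      have \<delta>: "0 < \<delta>" by (simp add: \<delta>_def)
      obtain k where k: "2 * c / \<delta> < 2 ^ k" using real_arch_pow[of 2 "2 * c / \<delta>"] by auto
      have "2 * c \<le> 2 ^ k * gap y" if y: "0 < gap y" "gap y powr - s \<le> R" for y
      proof -
        have "\<delta> \<le> (gap y powr - s) powr (- 1 / s)"
          unfolding \<delta>_def using y s by (intro powr_mono2') (auto simp: divide_nonpos_pos)
        also have "\<dots> = gap y"
          using y s by (simp add: powr_powr)
        finally have "2 ^ k * \<delta> \<le> 2 ^ k * gap y" by simp
        moreover have "2 * c < 2 ^ k * \<delta>" using k \<delta> by (simp add: pos_divide_less_eq)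
        ultimately show ?thesis by linarith
      qed
      then show ?thesis
        using reach_polarized by (intro exI[of _ "k + 3 * (CARD('n) - 2)"]) auto
    qed
  qed (use x rate \<open>0 \<le> \<rho>\<close> in \<open>auto simp: \<rho>_def\<close>)
  then show ?thesis
    by (simp only: prob_traj_eq_avg[OF finite_choice_E])
qed

lemma traj_stays_polarized:
  assumes "traj c (theta Ep \<alpha> \<beta>) x \<omega> t \<in> polarized" "range \<omega> \<subseteq> E"
  shows "traj c (theta Ep \<alpha> \<beta>) x \<omega> (t + d) = traj c (theta Ep \<alpha> \<beta>) x \<omega> t"
  using assms step_polarized by (induction d) auto

text \<open>The path space contains sequences of arbitrary node sets, whereas
  \<open>step_polarized\<close> needs a genuine edge at every time.\<close>

lemma AE_range_in_E: "AE \<omega> in pair_selection E. range \<omega> \<subseteq> E"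
proof -
  interpret finite_choice E step by (rule finite_choice_E)
  have "AE \<omega> in pair_selection E. \<omega> t \<in> E" for t
    unfolding pair_selection_def
    using fin nonempty
    by (intro AE_PiM_component[where P = "\<lambda>e. e \<in> E"])
      (auto intro: prob_space_measure_pmf simp: AE_measure_pmf_iff)
  then show ?thesis
    by (simp add: image_subset_iff AE_all_countable)
qed

lemma AE_polarized:
  assumes x: "x \<in> box" "0 < gap x" and s: "0 < s"
    and rate: "1 / card E * \<beta> powr - s + (1 - 1 / card E) * \<kappa> powr - s < 1"
  shows "AE \<omega> in pair_selection E. \<exists>t. traj c (theta Ep \<alpha> \<beta>) x \<omega> t \<in> polarized"
proof -
  interpret prob_space "pair_selection E" by (rule prob_space_pair_selection)
  let ?N = "\<Inter>t. {\<omega>. traj c (theta Ep \<alpha> \<beta>) x \<omega> t \<in> - polarized}"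
  have N: "?N \<in> sets (pair_selection E)" by measurable
  have "prob ?N \<le> prob {\<omega>. traj c (theta Ep \<alpha> \<beta>) x \<omega> t \<in> - polarized}" for t
    by (intro finite_measure_mono traj_mem_sets) auto
  then have "prob ?N \<le> 0"
    using nonpolarized_prob_tendsto_0[OF x s rate]
    by (intro LIMSEQ_le_const[of _ 0]) auto
  then have "?N \<in> null_sets (pair_selection E)"
    using N by (simp add: emeasure_eq_measure null_sets_def measure_le_0_iff)
  then show ?thesis
    by (rule AE_I') auto
qed

end

section \<open>Almost sure convergence\<close>

text \<open>The order of choice matters: \<open>s\<close> depends only on \<open>p\<close> and
  \<open>\<kappa>\<close> and puts the loss term below 1; a large \<open>\<beta>\<close> then makes
  the other term small.\<close>

lemma exists_contracting_exponent:
  fixes p \<kappa> :: real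
  assumes p: "0 < p" "p \<le> 1" and \<kappa>: "0 < \<kappa>" "\<kappa> < 1"
  shows "\<exists>s \<beta>0. 0 < s \<and> (\<forall>\<beta> > \<beta>0. p * \<beta> powr - s + (1 - p) * \<kappa> powr - s < 1)"
proof -
  \<comment> \<open>Solves \<open>\<kappa> powr - s = 1 + p / 2\<close>. The loss term becomes
    \<open>1 - p / 2 - p * p / 2\<close>, leaving room for \<open>p / 4\<close>, which is why the
    threshold for \<open>\<beta>\<close> is \<open>4 powr (1 / s)\<close>.\<close>
  define s where "s = ln (1 + p / 2) / - ln \<kappa>"
  have s: "0 < s" using p \<kappa> by (simp add: s_def divide_pos_neg)
  have "\<kappa> powr - s = 1 + p / 2"
    using p \<kappa> by (simp add: s_def powr_def)
  moreover have "p * \<beta> powr - s + (1 - p) * (1 + p / 2) < 1" if \<beta>: "4 powr (1 / s) < \<beta>" for \<beta>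
  proof -
    have "\<beta> powr - s \<le> (4 powr (1 / s)) powr - s"
      using \<beta> s by (intro powr_mono2') auto
    also have "\<dots> = 1 / 4" using s by (simp add: powr_powr powr_minus_divide)
    finally have "p * \<beta> powr - s \<le> p * (1 / 4)" using p by simp
    moreover have "(1 - p) * (1 + p / 2) = 1 - p / 2 - p * p / 2" by (simp add: field_simps)
    moreover have "0 < p * p" using p by simp
    ultimately show ?thesis using p by linarith
  qed
  ultimately show ?thesis using s by metis
qed

text \<open>The coincidence set is a hyperplane. Negligibility concerns the completed measure;
  measurability of the set brings it back to \<open>lborel\<close>.\<close>

lemma AE_lborel_component_neq:
  fixes i j :: "'n::finite"
  assumes "i \<noteq> j"
  shows "AE x in lborel. x $ i \<noteq> (x :: real ^ 'n) $ j"
proof -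
  have "axis i 1 - axis j (1 :: real) \<noteq> 0"
    using assms by (auto simp: axis_eq_axis)
  then have "negligible {x :: real ^ 'n. (axis i 1 - axis j 1) \<bullet> x = 0}"
    by (intro negligible_hyperplane) auto
  moreover have "{x :: real ^ 'n. (axis i 1 - axis j 1) \<bullet> x = 0} = {x. x $ i = x $ j}"
    by (simp add: inner_diff_left inner_axis')
  moreover have "{x :: real ^ 'n. x $ i = x $ j} \<in> sets lborel"
    by measurable
  ultimately have "{x :: real ^ 'n. x $ i = x $ j} \<in> null_sets lborel"
    by (simp add: negligible_iff_null_sets null_sets_completion_iff)
  then show ?thesis by (rule AE_I') auto
qed

text \<open>Convergence to a limit varying with \<open>\<omega>\<close> splits into the Cauchy
  property and an equation for \<open>lim\<close>, both measurable.\<close>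

lemma pred_LIMSEQ [measurable]:
  fixes f :: "nat \<Rightarrow> 'a \<Rightarrow> real"
  assumes [measurable]: "\<And>t. f t \<in> borel_measurable M" "l \<in> borel_measurable M"
  shows "Measurable.pred M (\<lambda>\<omega>. (\<lambda>t. f t \<omega>) \<longlonglongrightarrow> l \<omega>)"
proof -
  have "(\<lambda>t. f t \<omega>) \<longlonglongrightarrow> l \<omega> \<longleftrightarrow>
      Cauchy (\<lambda>t. f t \<omega>) \<and> lim (\<lambda>t. f t \<omega>) = l \<omega>" for \<omega>
    by (auto simp: Cauchy_convergent_iff convergent_LIMSEQ_iff limI intro: convergentI)
  then show ?thesis by simp
qed

lemma traj_component_measurable [measurable]:
  fixes x :: "real ^ 'n::finite"
  shows "(\<lambda>\<omega>. traj c th x \<omega> t $ i) \<in> borel_measurable (pair_selection E)"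
  by (rule measurable_compose[OF traj_measurable]) simp

theorem theorem4p3:
  fixes c \<alpha> :: real and V1 V2 :: "'n::finite set" and Ep En :: "'n set set"
  assumes "c > 0"
    and "complete_signed_graph UNIV Ep En"
    and "structurally_balanced UNIV Ep En V1 V2"
    and "0 < \<alpha>" and "\<alpha> < 1/2"
  shows "\<exists>\<beta>0 > 0. \<forall>\<beta> > \<beta>0.
    AE x0 in lborel. (\<forall>i. x0 $ i \<in> {-c..c}) \<longrightarrow>
      (\<exists>l. l \<in> borel_measurable (pair_selection (Ep \<union> En)) \<and>
           (\<forall>\<omega> \<in> space (pair_selection (Ep \<union> En)). l \<omega> \<in> {-c, c}) \<and>
           measure (pair_selection (Ep \<union> En))
             {\<omega> \<in> space (pair_selection (Ep \<union> En)).
                (\<forall>i \<in> V1. (\<lambda>t. traj c (theta Ep \<alpha> \<beta>) x0 \<omega> t $ i) \<longlonglongrightarrow> l \<omega>) \<and>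
                (\<forall>i \<in> V2. (\<lambda>t. traj c (theta Ep \<alpha> \<beta>) x0 \<omega> t $ i) \<longlonglongrightarrow> - l \<omega>)} = 1)"
proof -
  let ?E = "Ep \<union> En"
  let ?\<kappa> = "min (1/2) (1 - 2 * \<alpha>)"
  have dyn: "repelling_dynamics c \<alpha> \<beta> V1 V2 Ep En" if "1 / \<alpha> \<le> \<beta>" for \<beta>
    using assms that by unfold_locales
  \<comment> \<open>The edge set does not involve \<open>\<beta>\<close>, so the admissible value
    \<open>1 / \<alpha>\<close> suffices to see that it is nonempty.\<close>
  interpret E: finite_choice ?E "upd_step c (theta Ep \<alpha> (1 / \<alpha>))"
    using dyn[OF order_refl] by (rule repelling_dynamics.finite_choice_E)
  have "0 < 1 / real (card ?E)" "1 / real (card ?E) \<le> 1"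
    using E.card_pos by simp_all
  moreover have "0 < ?\<kappa>" "?\<kappa> < 1"
    using assms by (auto simp: min_def)
  ultimately have "\<exists>s \<beta>1. 0 < s \<and>
      (\<forall>\<beta> > \<beta>1. 1 / card ?E * \<beta> powr - s + (1 - 1 / card ?E) * ?\<kappa> powr - s < 1)"
    by (rule exists_contracting_exponent)
  then obtain s \<beta>1 where s: "0 < s" and rate: "\<And>\<beta>. \<beta>1 < \<beta> \<Longrightarrow>
      1 / card ?E * \<beta> powr - s + (1 - 1 / card ?E) * ?\<kappa> powr - s < 1"
    by blast
  show ?thesis
  \<comment> \<open>\<open>\<beta>1\<close> secures the drift, \<open>1 / \<alpha>\<close> the
    assumptions of \<open>repelling_dynamics\<close>.\<close>
  proof (intro exI[of _ "max \<beta>1 (1 / \<alpha>)"] conjI allI impI)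
    show "0 < max \<beta>1 (1 / \<alpha>)" using assms by (simp add: less_max_iff_disj)
    fix \<beta> assume \<beta>: "max \<beta>1 (1 / \<alpha>) < \<beta>"
    then interpret repelling_dynamics c \<alpha> \<beta> V1 V2 Ep En
      by (intro dyn) simp
    interpret paths: prob_space "pair_selection ?E" by (rule prob_space_pair_selection)
    let ?x = "traj c (theta Ep \<alpha> \<beta>)"
    have rate_\<beta>: "1 / card ?E * \<beta> powr - s + (1 - 1 / card ?E) * \<kappa> powr - s < 1"
      using rate \<beta> by (simp add: \<kappa>_def)
    obtain i0 j0 where ij: "opp i0 j0" using opp_exists by blast
    show "AE x0 in lborel. (\<forall>i. x0 $ i \<in> {-c..c}) \<longrightarrow>
      (\<exists>l. l \<in> borel_measurable (pair_selection ?E) \<and>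
           (\<forall>\<omega> \<in> space (pair_selection ?E). l \<omega> \<in> {-c, c}) \<and>
           measure (pair_selection ?E)
             {\<omega> \<in> space (pair_selection ?E).
                (\<forall>i \<in> V1. (\<lambda>t. ?x x0 \<omega> t $ i) \<longlonglongrightarrow> l \<omega>) \<and>
                (\<forall>i \<in> V2. (\<lambda>t. ?x x0 \<omega> t $ i) \<longlonglongrightarrow> - l \<omega>)} = 1)"
      \<comment> \<open>One fixed cross pair with distinct values makes the gap positive, so
        excluding a single hyperplane is enough.\<close>
      using AE_lborel_component_neq[OF opp_neq[OF ij]]
    proof (rule AE_mp, intro AE_I2 impI)
      fix x0 assume "x0 $ i0 \<noteq> x0 $ j0" "\<forall>i. x0 $ i \<in> {-c..c}"
      then have x0: "x0 \<in> box" "0 < gap x0"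
        using gap_ge[OF ij, of x0] by (auto simp: box_def)
      \<comment> \<open>Defined on all paths, with default \<open>- c\<close> on the null event that
        no polarized state is reached; asking only for a visit to the state \<open>target c\<close>
        keeps it measurable.\<close>
      define l where "l \<omega> = (if \<exists>t. \<forall>k. ?x x0 \<omega> t $ k = target c k then c else - c)" for \<omega>
      have l_meas [measurable]: "l \<in> borel_measurable (pair_selection ?E)"
        unfolding l_def by measurable
      have conv: "AE \<omega> in pair_selection ?E.
        (\<forall>i \<in> V1. (\<lambda>t. ?x x0 \<omega> t $ i) \<longlonglongrightarrow> l \<omega>) \<and>
        (\<forall>i \<in> V2. (\<lambda>t. ?x x0 \<omega> t $ i) \<longlonglongrightarrow> - l \<omega>)"
        using AE_range_in_E AE_polarized[OF x0 s rate_\<beta>]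
      proof eventually_elim
        case (elim \<omega>)
        then obtain t \<tau> where \<tau>: "\<tau> = - c \<or> \<tau> = c" "\<And>k. ?x x0 \<omega> t $ k = target \<tau> k"
          and t: "?x x0 \<omega> t \<in> polarized"
          by (auto simp: polarized_def)
        have const: "?x x0 \<omega> (d + t) $ k = target \<tau> k" for d k
          using traj_stays_polarized[OF t, of d] elim(1) \<tau>(2) by (simp add: add.commute)
        have "l \<omega> = \<tau>"
        proof (cases "\<exists>t. \<forall>k. ?x x0 \<omega> t $ k = target c k")
          case True
          then obtain t' where t': "\<And>k. ?x x0 \<omega> t' $ k = target c k" by blast
          then have "?x x0 \<omega> t' \<in> polarized" by (auto simp: polarized_def)
          \<comment> \<open>Both polarized states persist, so they coincide at time
            \<open>t' + t\<close>.\<close>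
          then have "target \<tau> i0 = target c i0"
            using traj_stays_polarized[of x0 \<omega> t' t] elim(1) const[of t' i0] t' by simp
          then show ?thesis using True by (simp add: l_def target_def split: if_splits)
        next
          case False
          then have "\<tau> \<noteq> c" using \<tau>(2) by blast
          then show ?thesis using False \<tau>(1) by (simp add: l_def)
        qed
        moreover have "(\<lambda>t. ?x x0 \<omega> t $ k) \<longlonglongrightarrow> target \<tau> k" for k
          by (rule LIMSEQ_offset[of _ t]) (simp add: const)
        ultimately show ?case
          unfolding target_def V2_eq by (metis ComplD)
      qed
      show "\<exists>l. l \<in> borel_measurable (pair_selection ?E) \<and>
           (\<forall>\<omega> \<in> space (pair_selection ?E). l \<omega> \<in> {-c, c}) \<and>
           measure (pair_selection ?E)
             {\<omega> \<in> space (pair_selection ?E).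
                (\<forall>i \<in> V1. (\<lambda>t. ?x x0 \<omega> t $ i) \<longlonglongrightarrow> l \<omega>) \<and>
                (\<forall>i \<in> V2. (\<lambda>t. ?x x0 \<omega> t $ i) \<longlonglongrightarrow> - l \<omega>)} = 1"
      proof (intro exI[of _ l] conjI l_meas)
        show "\<forall>\<omega> \<in> space (pair_selection ?E). l \<omega> \<in> {-c, c}"
          by (simp add: l_def)
        show "measure (pair_selection ?E)
             {\<omega> \<in> space (pair_selection ?E).
                (\<forall>i \<in> V1. (\<lambda>t. ?x x0 \<omega> t $ i) \<longlonglongrightarrow> l \<omega>) \<and>
                (\<forall>i \<in> V2. (\<lambda>t. ?x x0 \<omega> t $ i) \<longlonglongrightarrow> - l \<omega>)} = 1"
          using conv by (subst paths.prob_Collect_eq_1) (measurable; simp)+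
      qed
    qed
  qed
qed

end
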